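(* Let $n\geq 1$, let $D_1,D_2,\ldots,D_n\subset\mathbb{R}$ and $H_0,H_1,\ldots,H_n\subset\mathbb{R}$. Let $f_0:D_1\to H_0$ and $f_i:D_i\to H_i$ ($i=1,2,\ldots,n$) be bijective functions, where $f_i(x)\neq 0$ for all $x\in D_i$, $i=1,2,\ldots,n-1$. Let $D=D_1\times D_2\times\cdots\times D_n$ and define $F:D\to F(D)\subset\mathbb{R}^n$ by $$F(x_1,x_2,\ldots,x_n)=\left(f_0(x_1),\frac{f_2(x_2)}{f_1(x_1)},\frac{f_3(x_3)}{f_2(x_2)},\ldots,\frac{f_n(x_n)}{f_{n-1}(x_{n-1})}\right).$$ Then $F$ is invertible onto its image, and for every $(x_1,\ldots,x_n)\in H_0\times\mathbb{R}^{n-1}$, writing $a=f_1\bigl(f_0^{-1}(x_1)\bigr)$, if $a x_2x_3\cdots x_i\in H_i$ for all $i=2,3,\ldots,n$, then $(x_1,\ldots,x_n)\in F(D)$ and $$F^{-1}(x_1,x_2,\ldots,x_n)=\bigl(f_0^{-1}(x_1),\,f_2^{-1}(a x_2),\,f_3^{-1}(a x_2x_3),\ldots,f_n^{-1}(a x_2x_3\cdots x_n)\bigr).$$ *)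

theory Defs
  imports Complex_Main "HOL-Library.FuncSet"
begin

text \<open>
  A point \<open>(x\<^sub>1, \<dots>, x\<^sub>n)\<close> of \<open>\<real>\<^sup>n\<close> is an extensional function on \<open>{1..n}\<close>, i.e. an element of
  \<open>{1..n} \<rightarrow>\<^sub>E UNIV\<close>, so that equality of functions is equality of \<open>n\<close>-tuples.
\<close>

definition quotient_map :: "nat \<Rightarrow> (nat \<Rightarrow> real \<Rightarrow> real) \<Rightarrow> (nat \<Rightarrow> real) \<Rightarrow> (nat \<Rightarrow> real)" where
  "quotient_map n f x =
     (\<lambda>i\<in>{1..n}. if i = 1 then f 0 (x 1) else f i (x i) / f (i - 1) (x (i - 1)))"

end

theory Submission
  imports Defs
begin

text \<open>The system F(y) = x is triangular. Its first coordinate determines y_1 through the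
  injective f_0; once y_{i-1} is known, the i-th quotient, whose denominator is nonzero, determines
  f_i(y_i) and hence y_i. This gives injectivity (\<open>quotient_map_inj_on\<close>). Multiplying
  the quotients yields f_i(y_i) = a x_2 ... x_i with a = f_1(y_1), which dictates the formula for
  the inverse. When these products lie in the sets H_i, the inverses of the f_i can be applied to
  them, and \<open>quotient_map_eqI\<close> confirms that the resulting point is mapped to x; by
  injectivity it is the value of the inverse at x.\<close>

lemma quotient_map_inj_on:
  assumes inj0: "inj_on (f 0) (D 1)"
    and inj: "\<And>i. i \<in> {1..n} \<Longrightarrow> inj_on (f i) (D i)"
    and nz: "\<And>i x. i \<in> {1..n-1} \<Longrightarrow> x \<in> D i \<Longrightarrow> f i x \<noteq> 0"
  shows "inj_on (quotient_map n f) (PiE {1..n} D)"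
proof (rule inj_onI)
  fix y z
  assume y: "y \<in> PiE {1..n} D" and z: "z \<in> PiE {1..n} D"
    and eq: "quotient_map n f y = quotient_map n f z"
  have "y i = z i" if "1 \<le> i" "i \<le> n" for i
    using that
  proof (induction i rule: dec_induct)
    case base
    then have "f 0 (y 1) = f 0 (z 1)"
      using fun_cong[OF eq, of 1] by (simp add: quotient_map_def)
    moreover have "y 1 \<in> D 1" "z 1 \<in> D 1"
      using y z base by (auto elim: PiE_mem)
    ultimately show ?case
      using inj0 by (simp add: inj_on_def)
  next
    case (step i)
    \<comment> \<open>By the induction hypothesis y and z agree at i, so both quotients have the
      same denominator.\<close>
    then have "f (Suc i) (y (Suc i)) / f i (y i) = f (Suc i) (z (Suc i)) / f i (y i)"
      using fun_cong[OF eq, of "Suc i"] by (simp add: quotient_map_def)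
    moreover have "f i (y i) \<noteq> 0"
      using step.hyps step.prems y by (intro nz) (auto elim: PiE_mem)
    ultimately have "f (Suc i) (y (Suc i)) = f (Suc i) (z (Suc i))"
      by simp
    moreover have "y (Suc i) \<in> D (Suc i)" "z (Suc i) \<in> D (Suc i)"
      using y z step.prems by (auto elim: PiE_mem)
    ultimately show ?case
      using inj[of "Suc i"] step.prems by (simp add: inj_on_def)
  qed
  then show "y = z"
    using y z by (intro PiE_ext[of y _ D z]) auto
qed

text \<open>The quotients telescope, so the coordinates satisfy
  \<open>f\<^sub>i(y\<^sub>i) = f\<^sub>1(y\<^sub>1) x\<^sub>2 \<cdots> x\<^sub>i\<close>.\<close>

lemma quotient_map_eqI:
  assumes x: "x \<in> extensional {1..n}"
    and y: "\<And>i. i \<in> {1..n} \<Longrightarrow> y i \<in> D i"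
    and nz: "\<And>i t. i \<in> {1..n-1} \<Longrightarrow> t \<in> D i \<Longrightarrow> f i t \<noteq> 0"
    and first: "f 0 (y 1) = x 1"
    and prods: "\<And>i. i \<in> {1..n} \<Longrightarrow> f i (y i) = f 1 (y 1) * (\<Prod>j=2..i. x j)"
  shows "quotient_map n f y = x"
proof (rule extensionalityI)
  show "quotient_map n f y \<in> extensional {1..n}"
    by (simp add: quotient_map_def)
next
  fix i
  assume i: "i \<in> {1..n}"
  show "quotient_map n f y i = x i"
  proof (cases "i = 1")
    case True
    then show ?thesis
      using i first by (simp add: quotient_map_def)
  next
    case False
    with i obtain k where k: "i = Suc k" "1 \<le> k" "k < n"
      by (cases i) auto
    have "f k (y k) \<noteq> 0"
      using k by (intro nz y) auto
    \<comment> \<open>The products for i and k = i - 1 differ only in the last factor x_i; for k = 1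
      the product is empty.\<close>
    moreover have "f i (y i) = f k (y k) * x i"
      using k prods[of i] prods[of k] by (simp add: prod.nat_ivl_Suc')
    ultimately show ?thesis
      using i k by (simp add: quotient_map_def)
  qed
qed (use x in simp)

theorem theorem5p1:
  fixes n :: nat
    and D H :: "nat \<Rightarrow> real set"
    and f :: "nat \<Rightarrow> real \<Rightarrow> real"
  assumes "n \<ge> 1"
    and "bij_betw (f 0) (D 1) (H 0)"
    and "\<forall>i\<in>{1..n}. bij_betw (f i) (D i) (H i)"
    and "\<forall>i\<in>{1..n-1}. \<forall>x\<in>D i. f i x \<noteq> 0"
  shows "bij_betw (quotient_map n f) (PiE {1..n} D) (quotient_map n f ` PiE {1..n} D)
    \<and> (\<forall>x \<in> PiE {1..n} (\<lambda>i. if i = 1 then H 0 else UNIV).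
         let a = f 1 (inv_into (D 1) (f 0) (x 1)) in
           (\<forall>i\<in>{2..n}. a * (\<Prod>j=2..i. x j) \<in> H i) \<longrightarrow>
             x \<in> quotient_map n f ` PiE {1..n} D
             \<and> inv_into (PiE {1..n} D) (quotient_map n f) x =
                 (\<lambda>i\<in>{1..n}. if i = 1 then inv_into (D 1) (f 0) (x 1)
                            else inv_into (D i) (f i) (a * (\<Prod>j=2..i. x j))))"
proof (intro conjI ballI)
  have inj: "inj_on (quotient_map n f) (PiE {1..n} D)"
    using assms(2-4) by (intro quotient_map_inj_on) (auto simp: bij_betw_def)
  then show "bij_betw (quotient_map n f) (PiE {1..n} D) (quotient_map n f ` PiE {1..n} D)"
    by (rule inj_on_imp_bij_betw)
  fix x
  assume x: "x \<in> PiE {1..n} (\<lambda>i. if i = 1 then H 0 else UNIV)"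
  define a where "a = f 1 (inv_into (D 1) (f 0) (x 1))"
  define y where "y = (\<lambda>i\<in>{1..n}. if i = 1 then inv_into (D 1) (f 0) (x 1)
                            else inv_into (D i) (f i) (a * (\<Prod>j=2..i. x j)))"
  have "x \<in> quotient_map n f ` PiE {1..n} D \<and> inv_into (PiE {1..n} D) (quotient_map n f) x = y"
    if H: "\<forall>i\<in>{2..n}. a * (\<Prod>j=2..i. x j) \<in> H i"
  proof -
    have y1: "y 1 = inv_into (D 1) (f 0) (x 1)"
      using assms(1) by (simp add: y_def)
    have x1: "x 1 \<in> f 0 ` D 1"
      using PiE_mem[OF x, of 1] assms(1,2) by (simp add: bij_betw_def)
    \<comment> \<open>For i = 1 the product is empty and the equation is the definition of a;
      membership holds because f_0 and f_1 share the domain D_1. For i \<ge> 2 it is the hypothesis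
      on H_i and surjectivity of f_i.\<close>
    have coord: "y i \<in> D i \<and> f i (y i) = a * (\<Prod>j=2..i. x j)" if i: "i \<in> {1..n}" for i
    proof (cases "i = 1")
      case True
      then show ?thesis
        using inv_into_into[OF x1] y1 by (simp add: a_def)
    next
      case False
      then have "a * (\<Prod>j=2..i. x j) \<in> f i ` D i"
        using H i assms(3) by (auto simp: bij_betw_def)
      then show ?thesis
        using False i by (simp add: y_def inv_into_into f_inv_into_f)
    qed
    have mem: "y \<in> PiE {1..n} D"
      using coord by (auto simp: y_def)
    have map_y: "quotient_map n f y = x"
    proof (rule quotient_map_eqI[where D = D])
      show "f 0 (y 1) = x 1"
        using f_inv_into_f[OF x1] y1 by simp
    qed (use x coord assms(4) y1 in \<open>auto simp: a_def PiE_def\<close>)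
    \<comment> \<open>Since the map is injective, \<open>inv_into\<close> at x can only return the
      preimage y.\<close>
    show ?thesis
      using map_y mem inv_into_f_f[OF inj mem] by auto
  qed
  then show "let a = f 1 (inv_into (D 1) (f 0) (x 1)) in
           (\<forall>i\<in>{2..n}. a * (\<Prod>j=2..i. x j) \<in> H i) \<longrightarrow>
             x \<in> quotient_map n f ` PiE {1..n} D
             \<and> inv_into (PiE {1..n} D) (quotient_map n f) x =
                 (\<lambda>i\<in>{1..n}. if i = 1 then inv_into (D 1) (f 0) (x 1)
                            else inv_into (D i) (f i) (a * (\<Prod>j=2..i. x j)))"
    unfolding Let_def a_def y_def by blast
qed

end
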